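(* Let $\mathbb{F}$ be a field, let $p,q,m\ge 1$ be integers, let $A_1,\ldots,A_m\in M_{p,q}(\mathbb{F})$ and let $g=(g_1,\ldots,g_m)^T\in\mathbb{F}^m$. Let $\mathcal{A}=(\mathrm{vec}\,A_1,\ldots,\mathrm{vec}\,A_m)$ be the $pq$-by-$m$ matrix with columns $\mathrm{vec}\,A_i$. Then the set of solutions $(x,y)\in\mathbb{F}^q\times\mathbb{F}^p$ of the bilinear system $$y^TA_ix=g_i,\quad i=1,\ldots,m,$$ is equal to the set of solutions $(x,y)\in\mathbb{F}^q\times\mathbb{F}^p$ of the equation $$\mathcal{A}^T\,\mathrm{vec}\,K=g,\quad\text{in which } K=yx^T.$$
   Context: $M_{p,q}(\mathbb{F})$ denotes the $p$-by-$q$ matrices over $\mathbb{F}$. For $A=(a_{ij})\in M_{p,q}(\mathbb{F})$, $\mathrm{vec}(A)\in\mathbb{F}^{pq}$ is the column vector obtained by stacking the columns of $A$, starting with column 1: its $(kp+r)$-th entry is $a_{r,k+1}$ for $k=0,1,\ldots,q-1$ and $1\le r\le p$. A solution of a bilinear system is a pair of vectors $x\in\mathbb{F}^q$, $y\in\mathbb{F}^p$ satisfying all $m$ equations simultaneously. *)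

theory Defs
  imports "Jordan_Normal_Form.Matrix"
begin

(* Column stacking.  Indices of vectors and matrices start at 0 here, so with p = dim_row A
   the entry at position k * p + r is the (r, k) entry of A, for r < p and k < dim_col A. *)
definition vec_of_mat :: "'a mat \<Rightarrow> 'a vec" where
  "vec_of_mat A = vec (dim_row A * dim_col A) (\<lambda>i. A $$ (i mod dim_row A, i div dim_row A))"

lemma vec_of_mat_carrier [simp]:
  "A \<in> carrier_mat p q \<Longrightarrow> vec_of_mat A \<in> carrier_vec (p * q)"
  by (auto simp: vec_of_mat_def)

lemma vec_of_mat_index:
  assumes "A \<in> carrier_mat p q" "r < p" "k < q"
  shows "vec_of_mat A $ (k * p + r) = A $$ (r, k)"
proof -
  have "k * p + r < (k + 1) * p" using assms(2) by simp
  also have "\<dots> \<le> q * p" using assms(3) by (intro mult_le_mono1) simp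
  finally have "k * p + r < p * q" by (simp add: mult.commute)
  then show ?thesis using assms by (simp add: vec_of_mat_def)
qed

end

theory Submission
  imports Defs
begin

text \<open>Pairing vec A with vec B gives the entrywise sum of a_rk b_rk
  (\<open>vec_of_mat_scalar_prod\<close>). For B = y x^T the entries are b_rk = y_r x_k
  (\<open>outer_prod_index\<close>), so the pairing is the sum of a_rk y_r x_k, which is y^T A x
  (\<open>bilinear_form_eq_scalar_prod_vec\<close>). Row i of the transposed coefficient matrix is
  vec A_i, so for each pair (x, y) the two systems agree equation by equation.\<close>

lemma vec_of_mat_scalar_prod:
  fixes A B :: "'a :: comm_semiring_0 mat"
  assumes "A \<in> carrier_mat p q" "B \<in> carrier_mat p q"
  shows "vec_of_mat A \<bullet> vec_of_mat B = (\<Sum>k<q. \<Sum>r<p. A $$ (r, k) * B $$ (r, k))"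
proof -
  let ?f = "\<lambda>i. vec_of_mat A $ i * vec_of_mat B $ i"
  have "vec_of_mat A \<bullet> vec_of_mat B = sum ?f {..<q * p}"
    using vec_of_mat_carrier[OF assms(2)]
    by (auto simp: scalar_prod_def mult.commute lessThan_atLeast0)
  \<comment> \<open>The q * p positions split into q consecutive blocks of length p; block k holds
    column k of each matrix.\<close>
  also have "\<dots> = (\<Sum>k<q. sum ?f {k * p..<k * p + p})"
    by (rule sum.nat_group[symmetric])
  also have "\<dots> = (\<Sum>k<q. \<Sum>r<p. ?f (k * p + r))"
    using sum.shift_bounds_nat_ivl[of ?f 0 "k * p" p for k]
    by (simp add: add.commute lessThan_atLeast0)
  also have "\<dots> = (\<Sum>k<q. \<Sum>r<p. A $$ (r, k) * B $$ (r, k))"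
    by (intro sum.cong refl) (simp add: vec_of_mat_index[OF assms(1)] vec_of_mat_index[OF assms(2)])
  finally show ?thesis .
qed

text \<open>The outer product is encoded as a one-column matrix times a one-row matrix, so each
  entry is a sum with a single term.\<close>

lemma outer_prod_index:
  fixes x y :: "'a :: semiring_0 vec"
  assumes "r < p" "k < q" "x \<in> carrier_vec q" "y \<in> carrier_vec p"
  shows "(mat_of_cols p [y] * transpose_mat (mat_of_cols q [x])) $$ (r, k) = y $ r * x $ k"
  using assms by (simp add: scalar_prod_def mat_of_cols_def)

lemma bilinear_form_eq_scalar_prod_vec:
  fixes A :: "'a :: comm_semiring_0 mat"
  assumes A: "A \<in> carrier_mat p q" and x: "x \<in> carrier_vec q" and y: "y \<in> carrier_vec p"
  shows "y \<bullet> (A *\<^sub>v x) =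
    vec_of_mat A \<bullet> vec_of_mat (mat_of_cols p [y] * transpose_mat (mat_of_cols q [x]))"
    (is "_ = _ \<bullet> vec_of_mat ?K")
proof -
  have K: "?K \<in> carrier_mat p q" by (rule carrier_matI) simp_all
  have "y \<bullet> (A *\<^sub>v x) = (\<Sum>r<p. \<Sum>k<q. A $$ (r, k) * (y $ r * x $ k))"
    using A x by (simp add: scalar_prod_def lessThan_atLeast0 sum_distrib_left mult_ac)
  \<comment> \<open>The bilinear form sums row by row, whereas column stacking needs the column
    index outermost.\<close>
  also have "\<dots> = (\<Sum>k<q. \<Sum>r<p. A $$ (r, k) * (y $ r * x $ k))"
    by (rule sum.swap)
  also have "\<dots> = vec_of_mat A \<bullet> vec_of_mat ?K"
    unfolding vec_of_mat_scalar_prod[OF A K]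
    by (intro sum.cong refl) (simp only: outer_prod_index[OF _ _ x y] lessThan_iff)
  finally show ?thesis .
qed

theorem theorem3p1:
  fixes p q m :: nat
    and A :: "nat \<Rightarrow> 'a :: field mat"
    and g :: "'a vec"
  assumes "p \<ge> 1" and "q \<ge> 1" and "m \<ge> 1"
    and "\<And>i. i < m \<Longrightarrow> A i \<in> carrier_mat p q"
    and "g \<in> carrier_vec m"
  shows "{(x, y). x \<in> carrier_vec q \<and> y \<in> carrier_vec p \<and>
            (\<forall>i<m. y \<bullet> (A i *\<^sub>v x) = g $ i)} =
         {(x, y). x \<in> carrier_vec q \<and> y \<in> carrier_vec p \<and>
            (let K = mat_of_cols p [y] * transpose_mat (mat_of_cols q [x])
             in transpose_mat (mat_of_cols (p * q) (map (\<lambda>i. vec_of_mat (A i)) [0..<m]))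
                  *\<^sub>v vec_of_mat K = g)}"
proof -
  let ?M = "transpose_mat (mat_of_cols (p * q) (map (\<lambda>i. vec_of_mat (A i)) [0..<m]))"
  \<comment> \<open>Transposition turns column i into row i. That column is
    \<open>vec_of_mat (A i)\<close> itself because the vector has length p * q.\<close>
  have "(?M *\<^sub>v v) $ i = vec_of_mat (A i) \<bullet> v" if "i < m" for i v
    using that vec_of_mat_carrier[OF assms(4)[OF that]] by simp
  \<comment> \<open>Both vectors have dimension m, so equality can be tested entrywise.\<close>
  then have "?M *\<^sub>v v = g \<longleftrightarrow> (\<forall>i<m. vec_of_mat (A i) \<bullet> v = g $ i)" for v
    using assms(5) by (auto simp: vec_eq_iff)
  then show ?thesis
    by (auto simp: Let_def bilinear_form_eq_scalar_prod_vec[OF assms(4)])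
qed

end
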